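(* Let $G$ be a connected simple undirected graph with edge lengths $\ell\colon E(G)\to\mathbb{R}_{>0}$, and let $\varphi,\psi\colon\mathbb{R}\to\mathbb{R}$ be non-decreasing functions. If $C\subseteq E(G)$ is a $\varphi$-contraction for $G$ and $C'$ is a $\psi$-contraction for the contracted graph $G/C$, then $C\cup C'$ is a $(\psi\circ\varphi)$-contraction for $G$, where $(\psi\circ\varphi)(x)=\psi(\varphi(x))$. The same holds with "weak $\varphi$-contraction", "weak $\psi$-contraction" and "weak $(\psi\circ\varphi)$-contraction" in place of the respective non-weak notions.
   Context: For $C\subseteq E$, $G/C$ is the simple graph obtained from $G$ by contracting the edges of $C$, deleting loops and keeping among parallel edges only one of minimum length; equivalently for distances, $\ell_C$ is the length function equal to $0$ on $C$ and to $\ell$ on $E\setminus C$, and $\mathrm{dist}_{\ell}(u,v)$ denotes shortest-path distance with respect to $\ell$. A tolerance function is a non-decreasing $\varphi\colon\mathbb{R}\to\mathbb{R}$. A set $C\subseteq E$ is a $\varphi$-contraction if $\mathrm{dist}_{\ell_C}(u,v)\ge\varphi(\mathrm{dist}_\ell(u,v))$ for all vertices $u,v$. It is a weak $\varphi$-contraction if for all $u,v$ either $\mathrm{dist}_{\ell_C}(u,v)=0$ or $\mathrm{dist}_{\ell_C}(u,v)\ge\varphi(\mathrm{dist}_\ell(u,v))$, and the graph $(V,C)$ is disconnected. Edges of $C'$ in $G/C$ are identified with the corresponding edges of $G$. *)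

theory Defs
  imports Complex_Main
begin

text \<open>
  An undirected simple graph is a vertex set \<open>V\<close> together with a set \<open>E\<close> of two-element
  subsets of \<open>V\<close>. Finiteness is not built in: distances are infima over paths, and the two
  lemmas with finiteness premises below show that for finite graphs these infima are minima and
  that a shortest edge can be kept in every class of parallel edges.
\<close>

definition simple_graph :: "'a set \<Rightarrow> 'a set set \<Rightarrow> bool" where
  "simple_graph V E \<longleftrightarrow> (\<forall>e\<in>E. \<exists>u\<in>V. \<exists>v\<in>V. u \<noteq> v \<and> e = {u, v})"

fun path_edges :: "'a list \<Rightarrow> 'a set list" where
  "path_edges [] = []"
| "path_edges [x] = []"
| "path_edges (x # y # zs) = {x, y} # path_edges (y # zs)"

definition path_between :: "'a set \<Rightarrow> 'a set set \<Rightarrow> 'a \<Rightarrow> 'a \<Rightarrow> 'a list \<Rightarrow> bool" where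
  "path_between V E u v p \<longleftrightarrow>
     p \<noteq> [] \<and> hd p = u \<and> last p = v \<and> distinct p \<and> set p \<subseteq> V \<and> set (path_edges p) \<subseteq> E"

definition connected_graph :: "'a set \<Rightarrow> 'a set set \<Rightarrow> bool" where
  "connected_graph V E \<longleftrightarrow> V \<noteq> {} \<and> (\<forall>u\<in>V. \<forall>v\<in>V. \<exists>p. path_between V E u v p)"

definition path_length :: "('a set \<Rightarrow> real) \<Rightarrow> 'a list \<Rightarrow> real" where
  "path_length l p = sum_list (map l (path_edges p))"

definition graph_dist :: "'a set \<Rightarrow> 'a set set \<Rightarrow> ('a set \<Rightarrow> real) \<Rightarrow> 'a \<Rightarrow> 'a \<Rightarrow> real" where
  "graph_dist V E l u v = (INF p\<in>{p. path_between V E u v p}. path_length l p)"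

definition zero_on :: "'a set set \<Rightarrow> ('a set \<Rightarrow> real) \<Rightarrow> 'a set \<Rightarrow> real" where
  "zero_on C l e = (if e \<in> C then 0 else l e)"

definition contraction ::
  "'a set \<Rightarrow> 'a set set \<Rightarrow> ('a set \<Rightarrow> real) \<Rightarrow> (real \<Rightarrow> real) \<Rightarrow> 'a set set \<Rightarrow> bool" where
  "contraction V E l \<phi> C \<longleftrightarrow> C \<subseteq> E \<and>
     (\<forall>u\<in>V. \<forall>v\<in>V. graph_dist V E (zero_on C l) u v \<ge> \<phi> (graph_dist V E l u v))"

definition weak_contraction ::
  "'a set \<Rightarrow> 'a set set \<Rightarrow> ('a set \<Rightarrow> real) \<Rightarrow> (real \<Rightarrow> real) \<Rightarrow> 'a set set \<Rightarrow> bool" where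
  "weak_contraction V E l \<phi> C \<longleftrightarrow> C \<subseteq> E \<and>
     (\<forall>u\<in>V. \<forall>v\<in>V. graph_dist V E (zero_on C l) u v = 0 \<or>
        graph_dist V E (zero_on C l) u v \<ge> \<phi> (graph_dist V E l u v)) \<and>
     \<not> connected_graph V C"

text \<open>
  The vertices of \<open>G/C\<close> are the (vertex sets of the) connected components of \<open>(V, C)\<close>; its edges
  are the unordered pairs of distinct components joined by an edge of \<open>G\<close>. Taking a set of pairs
  removes loops and merges parallel edges.
\<close>

definition component :: "'a set \<Rightarrow> 'a set set \<Rightarrow> 'a \<Rightarrow> 'a set" where
  "component V C v = {w \<in> V. \<exists>p. path_between V C v w p}"

definition contract_verts :: "'a set \<Rightarrow> 'a set set \<Rightarrow> 'a set set" where
  "contract_verts V C = component V C ` V"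

definition contract_edges :: "'a set \<Rightarrow> 'a set set \<Rightarrow> 'a set set \<Rightarrow> 'a set set set" where
  "contract_edges V E C =
     {{component V C u, component V C v} | u v.
        {u, v} \<in> E \<and> component V C u \<noteq> component V C v}"

text \<open>
  \<open>r e\<close> is the edge of \<open>G\<close> that survives as the edge \<open>e\<close> of \<open>G/C\<close>: an edge of minimum length
  among the parallel edges of \<open>G\<close> joining the two components of \<open>e\<close>. The choice need not be unique,
  so it is a parameter \<open>r\<close>. The edge \<open>e\<close> has length \<open>l (r e)\<close>, and a set \<open>D\<close> of edges of \<open>G/C\<close> is
  identified with the set \<open>r ` D\<close> of edges of \<open>G\<close>.
\<close>

definition keeps_shortest_parallel ::
  "'a set \<Rightarrow> 'a set set \<Rightarrow> ('a set \<Rightarrow> real) \<Rightarrow> 'a set set \<Rightarrow> ('a set set \<Rightarrow> 'a set) \<Rightarrow> bool" where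
  "keeps_shortest_parallel V E l C r \<longleftrightarrow>
     (\<forall>e\<in>contract_edges V E C.
        r e \<in> E \<and> component V C ` r e = e \<and>
        (\<forall>f\<in>E. component V C ` f = e \<longrightarrow> l (r e) \<le> l f))"

lemma simple_graph_contract:
  assumes "simple_graph V E"
  shows "simple_graph (contract_verts V C) (contract_edges V E C)"
proof -
  have V: "u \<in> V" "v \<in> V" if uv: "{u, v} \<in> E" for u v
  proof -
    from assms uv obtain a b where "a \<in> V" "b \<in> V" "{u, v} = {a, b}"
      unfolding simple_graph_def by blast
    then show "u \<in> V" "v \<in> V" by (auto simp: doubleton_eq_iff)
  qed
  show ?thesis unfolding simple_graph_def
  proof
    fix e assume "e \<in> contract_edges V E C"
    then obtain u v where "{u, v} \<in> E" "component V C u \<noteq> component V C v"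
      "e = {component V C u, component V C v}"
      unfolding contract_edges_def by blast
    with V[of u v]
    show "\<exists>x\<in>contract_verts V C. \<exists>y\<in>contract_verts V C. x \<noteq> y \<and> e = {x, y}"
      unfolding contract_verts_def by (intro bexI[of _ "component V C u"] bexI[of _ "component V C v"]) auto
  qed
qed

lemma keeps_shortest_parallel_exists:
  assumes "finite E"
  shows "\<exists>r. keeps_shortest_parallel V E l C r"
proof -
  have "\<exists>g. g \<in> E \<and> component V C ` g = e \<and>
      (\<forall>f\<in>E. component V C ` f = e \<longrightarrow> l g \<le> l f)"
    if "e \<in> contract_edges V E C" for e
  proof -
    let ?P = "{f \<in> E. component V C ` f = e}"
    from that obtain u v where "{u, v} \<in> E" "e = {component V C u, component V C v}"
      unfolding contract_edges_def by blast
    then have "{u, v} \<in> ?P" by simp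
    then have ne: "?P \<noteq> {}" by (rule ex_in_conv[THEN iffD1, OF exI])
    have fin: "finite ?P" using assms by simp
    define g where "g = arg_min_on l ?P"
    have "g \<in> ?P" unfolding g_def by (rule arg_min_if_finite(1)[OF fin ne])
    moreover have "l g \<le> l f" if "f \<in> ?P" for f
      unfolding g_def by (rule arg_min_least[OF fin ne that])
    ultimately show ?thesis by (intro exI[of _ g]) simp
  qed
  then show ?thesis
    unfolding keeps_shortest_parallel_def
    by (intro exI[of _ "\<lambda>e. SOME g. g \<in> E \<and> component V C ` g = e \<and>
      (\<forall>f\<in>E. component V C ` f = e \<longrightarrow> l g \<le> l f)"] ballI) (rule someI_ex)
qed

lemma graph_dist_attained:
  assumes "finite V" "connected_graph V E" "u \<in> V" "v \<in> V"
  shows "\<exists>p. path_between V E u v p \<and> graph_dist V E l u v = path_length l p \<and>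
    (\<forall>q. path_between V E u v q \<longrightarrow> path_length l p \<le> path_length l q)"
proof -
  let ?P = "{p. path_between V E u v p}"
  have "?P \<subseteq> {p. set p \<subseteq> V \<and> distinct p}" unfolding path_between_def by blast
  then have fin: "finite ?P"
    using finite_subset_distinct[OF assms(1)] finite_subset by blast
  have ne: "?P \<noteq> {}" using assms(2-4) unfolding connected_graph_def by blast
  define p where "p = arg_min_on (path_length l) ?P"
  have p: "p \<in> ?P" unfolding p_def by (rule arg_min_if_finite(1)[OF fin ne])
  have le: "path_length l p \<le> path_length l q" if "q \<in> ?P" for q
    unfolding p_def by (rule arg_min_least[OF fin ne that])
  have "graph_dist V E l u v = path_length l p"
    unfolding graph_dist_def by (rule cInf_eq_minimum) (use p le in auto)
  with p le show ?thesis by (intro exI[of _ p]) simp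
qed

end

theory Submission
  imports Defs
begin

text \<open>
  Distances are compared through walks. The projection \<open>V \<rightarrow> V/C\<close> turns a walk of \<open>G\<close> into one of
  \<open>G/C\<close> that is no longer when \<open>r ` C'\<close> resp. \<open>C'\<close> has length zero; conversely a walk of \<open>G/C\<close> lifts
  to \<open>G\<close> by inserting zero-length walks inside the components of \<open>(V, C)\<close>. So, with \<open>C\<close> of length
  zero, \<open>G\<close> and \<open>G/C\<close> have the same distances, both before and after contracting \<open>C'\<close>, and the
  two contraction inequalities compose by monotonicity of \<open>\<psi>\<close>. In the weak case a distance that is
  zero after contracting \<open>C\<close> remains zero.
\<close>

section \<open>Walks with accumulated length\<close>

text \<open>Vertices may repeat, so walks concatenate and survive non-injective vertex maps, which
  the \<open>distinct\<close> lists of \<open>path_between\<close> do not.\<close>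

inductive walk :: "'a set \<Rightarrow> 'a set set \<Rightarrow> ('a set \<Rightarrow> real) \<Rightarrow> 'a \<Rightarrow> 'a \<Rightarrow> real \<Rightarrow> bool"
  for V E l where
  refl: "u \<in> V \<Longrightarrow> walk V E l u u 0"
| step: "u \<in> V \<Longrightarrow> {u, w} \<in> E \<Longrightarrow> walk V E l w v c \<Longrightarrow> walk V E l u v (l {u, w} + c)"

lemma walk_verts: "walk V E l u v c \<Longrightarrow> u \<in> V \<and> v \<in> V"
  by (induction rule: walk.induct) auto

lemma walk_trans: "walk V E l u v c \<Longrightarrow> walk V E l v w d \<Longrightarrow> walk V E l u w (c + d)"
proof (induction rule: walk.induct)
  case (step u w v c)
  then show ?case using walk.step[of u V w E l _ "c + d"] by (simp add: add.assoc)
qed simp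

lemma walk_sym: "walk V E l u v c \<Longrightarrow> walk V E l v u c"
proof (induction rule: walk.induct)
  case (refl u)
  then show ?case by (rule walk.refl)
next
  case (step u w v c)
  have "w \<in> V" using walk_verts[OF step.hyps(3)] by simp
  then have "walk V E l w u (l {w, u} + 0)"
    using step.hyps by (intro walk.step walk.refl) (simp_all add: insert_commute)
  from walk_trans[OF step.IH this] show ?case by (simp add: insert_commute add.commute)
qed

text \<open>An edge whose ends are identified by \<open>f\<close> is dropped, which costs nothing as
  \<open>l\<close> is nonnegative; any other edge is replaced by its image, which is no
  longer.\<close>

lemma walk_project:
  assumes "walk V E l u v c" and "\<And>x. x \<in> V \<Longrightarrow> f x \<in> V'" and "\<And>e. e \<in> E \<Longrightarrow> l e \<ge> 0"
    and edge: "\<And>x y. x \<in> V \<Longrightarrow> y \<in> V \<Longrightarrow> {x, y} \<in> E \<Longrightarrow>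
      f x = f y \<or> {f x, f y} \<in> E' \<and> l' {f x, f y} \<le> l {x, y}"
  shows "\<exists>c'\<le>c. walk V' E' l' (f u) (f v) c'"
  using assms(1)
proof (induction rule: walk.induct)
  case (refl u)
  then show ?case using walk.refl[OF assms(2)] by (intro exI[of _ 0]) simp
next
  case (step u w v c)
  then obtain c' where c': "c' \<le> c" "walk V' E' l' (f w) (f v) c'" by blast
  have "w \<in> V" using walk_verts[OF step.hyps(3)] by simp
  from edge[OF step.hyps(1) this step.hyps(2)] show ?case
  proof
    assume "f u = f w"
    then show ?thesis using c' assms(3)[OF step.hyps(2)] by (intro exI[of _ c']) auto
  next
    assume "{f u, f w} \<in> E' \<and> l' {f u, f w} \<le> l {u, w}"
    then show ?thesis using c' walk.step[of "f u" V' "f w" E' l'] assms(2)[OF step.hyps(1)]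
      by (intro exI[of _ "l' {f u, f w} + c'"]) auto
  qed
qed

section \<open>Paths, walks and distances\<close>

lemma path_imp_walk:
  assumes "path_between V E u v p"
  shows "walk V E l u v (path_length l p)"
  using assms
proof (induction p arbitrary: u rule: path_edges.induct)
  case (3 x y zs)
  then have "path_between V E y v (y # zs)" by (auto simp: path_between_def)
  from "3.IH"[OF this] show ?case
    using "3.prems" walk.step[of x V y E l v] by (auto simp: path_between_def path_length_def)
qed (auto simp: path_between_def path_length_def intro: walk.refl)

text \<open>The cut vertex \<open>y\<close> is kept in both halves, so that no edge at the cut is
  lost.\<close>

lemma path_edges_append_Cons:
  "path_edges (xs @ y # ys) = path_edges (xs @ [y]) @ path_edges (y # ys)"
  by (induction xs rule: path_edges.induct) (auto, (cases ys; simp)?)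

text \<open>Loop removal: if the new first vertex already lies on the path, the part before that
  occurrence is cut off, and by nonnegativity the rest is no longer.\<close>

lemma walk_imp_path:
  assumes "walk V E l u v c" and nonneg: "\<And>e. e \<in> E \<Longrightarrow> l e \<ge> 0"
  shows "\<exists>p. path_between V E u v p \<and> path_length l p \<le> c"
  using assms(1)
proof (induction rule: walk.induct)
  case (refl u)
  then show ?case by (intro exI[of _ "[u]"]) (auto simp: path_between_def path_length_def)
next
  case (step u w v c)
  then obtain p where p: "path_between V E w v p" "path_length l p \<le> c" by blast
  show ?case
  proof (cases "u \<in> set p")
    case True
    then obtain xs ys where xy: "p = xs @ u # ys" by (meson split_list)
    have "sum_list (map l (path_edges (xs @ [u]))) \<ge> 0"
      using p(1) unfolding xy path_between_def path_edges_append_Cons[of xs u ys]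
      by (intro sum_list_nonneg) (auto intro!: nonneg)
    then have "path_length l (u # ys) \<le> path_length l p"
      unfolding xy path_length_def path_edges_append_Cons[of xs u ys] by simp
    moreover have "path_between V E u v (u # ys)"
      using p(1) unfolding xy path_between_def path_edges_append_Cons[of xs u ys] by auto
    ultimately show ?thesis using p(2) nonneg[OF step.hyps(2)] by (intro exI[of _ "u # ys"]) auto
  next
    case False
    obtain zs where "p = w # zs" using p(1) unfolding path_between_def by (cases p) auto
    then show ?thesis using False p step.hyps
      by (intro exI[of _ "u # p"]) (auto simp: path_between_def path_length_def)
  qed
qed

text \<open>With all lengths zero, \<open>walk\<close> is plain reachability, so concatenation,
  reversal and projection apply to \<open>component\<close> and
  \<open>connected_graph\<close>.\<close>

lemma path_iff_walk: "(\<exists>p. path_between V E u v p) \<longleftrightarrow> walk V E (\<lambda>_. 0) u v 0"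
proof
  assume "\<exists>p. path_between V E u v p"
  then obtain p where "path_between V E u v p" ..
  from path_imp_walk[OF this, of "\<lambda>_. 0"] show "walk V E (\<lambda>_. 0) u v 0"
    by (simp add: path_length_def map_replicate_const sum_list_replicate)
next
  assume "walk V E (\<lambda>_. 0) u v 0"
  from walk_imp_path[OF this] show "\<exists>p. path_between V E u v p" by auto
qed

lemma graph_dist_le_walk:
  assumes "walk V E l u v c" and nonneg: "\<And>e. e \<in> E \<Longrightarrow> l e \<ge> 0"
  shows "graph_dist V E l u v \<le> c"
proof -
  obtain p where p: "path_between V E u v p" "path_length l p \<le> c"
    using walk_imp_path[OF assms] by blast
  \<comment> \<open>The set of paths may be infinite, so the real infimum needs an explicit lower
    bound.\<close>
  have "bdd_below (path_length l ` {p. path_between V E u v p})"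
    by (rule bdd_belowI2[of _ 0])
      (auto simp: path_between_def path_length_def intro!: sum_list_nonneg nonneg)
  then have "graph_dist V E l u v \<le> path_length l p"
    unfolding graph_dist_def using p by (intro cINF_lower) auto
  then show ?thesis using p by simp
qed

text \<open>The path \<open>p\<close> only ensures that the infimum is over a nonempty set.\<close>

lemma graph_dist_greatest:
  assumes "path_between V E u v p" and "\<And>c. walk V E l u v c \<Longrightarrow> d \<le> c"
  shows "d \<le> graph_dist V E l u v"
  unfolding graph_dist_def using assms path_imp_walk by (intro cINF_greatest) fastforce+

lemma graph_dist_le_graph_dist:
  assumes "path_between V E u v p"
    and "\<And>e. e \<in> E' \<Longrightarrow> l' e \<ge> 0"
    and "\<And>c. walk V E l u v c \<Longrightarrow> \<exists>c'\<le>c. walk V' E' l' u' v' c'"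
  shows "graph_dist V' E' l' u' v' \<le> graph_dist V E l u v"
proof (rule graph_dist_greatest[OF assms(1)])
  fix c
  assume "walk V E l u v c"
  then obtain c' where "c' \<le> c" "walk V' E' l' u' v' c'" using assms(3) by blast
  then show "graph_dist V' E' l' u' v' \<le> c"
    using graph_dist_le_walk[OF _ assms(2)] by fastforce
qed

section \<open>Components as reachability classes\<close>

lemma mem_component_iff: "w \<in> component V C v \<longleftrightarrow> walk V C (\<lambda>_. 0) v w 0"
  unfolding component_def path_iff_walk using walk_verts[of V C _ v w 0] by auto

text \<open>Reachability is an equivalence relation: reflexivity puts \<open>v\<close> into its own
  component, and symmetry and transitivity give the converse.\<close>

lemma component_eq_iff:
  assumes "u \<in> V" "v \<in> V"
  shows "component V C u = component V C v \<longleftrightarrow> walk V C (\<lambda>_. 0) u v 0"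
proof
  assume "component V C u = component V C v"
  then show "walk V C (\<lambda>_. 0) u v 0"
    using assms walk.refl mem_component_iff by metis
next
  assume "walk V C (\<lambda>_. 0) u v 0"
  then show "component V C u = component V C v"
    using walk_trans walk_sym by (fastforce simp: set_eq_iff mem_component_iff)
qed

lemma component_eq_of_edge:
  assumes "u \<in> V" "v \<in> V" "{u, v} \<in> C"
  shows "component V C u = component V C v"
  using walk.step[OF assms(1,3) walk.refl[OF assms(2)], of "\<lambda>_. 0"] assms
  by (simp add: component_eq_iff)

section \<open>The contracted graph and its surviving edges\<close>

text \<open>The setting shared by both versions of the theorem; each supplies \<open>C_sub\<close>
  from its own hypothesis on \<open>C\<close>.\<close>

locale contracted_graph =
  fixes V :: "'a set" and E C :: "'a set set" and l :: "'a set \<Rightarrow> real"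
    and r :: "'a set set \<Rightarrow> 'a set"
  assumes simple: "simple_graph V E" and connected: "connected_graph V E"
    and pos: "\<forall>e\<in>E. l e > 0"
    and shortest: "keeps_shortest_parallel V E l C r"
    and C_sub: "C \<subseteq> E"
begin

abbreviation "cV \<equiv> contract_verts V C"
abbreviation "cE \<equiv> contract_edges V E C"
abbreviation "cc \<equiv> component V C"

lemma zero_on_nonneg: "e \<in> E \<Longrightarrow> zero_on X l e \<ge> 0"
  using pos by (auto simp: zero_on_def less_imp_le)

lemma r_in_E: "e \<in> cE \<Longrightarrow> r e \<in> E"
  using shortest by (auto simp: keeps_shortest_parallel_def)

lemma component_image_r: "e \<in> cE \<Longrightarrow> cc ` r e = e"
  using shortest by (auto simp: keeps_shortest_parallel_def)

lemma length_r_le: "e \<in> cE \<Longrightarrow> f \<in> E \<Longrightarrow> cc ` f = e \<Longrightarrow> l (r e) \<le> l f"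
  using shortest by (simp add: keeps_shortest_parallel_def)

lemma component_edge_of_r:
  assumes "C' \<subseteq> cE" "{x, y} \<in> r ` C'"
  shows "{cc x, cc y} \<in> C'"
proof -
  from assms(2) obtain d where d: "{x, y} = r d" "d \<in> C'" by (rule imageE)
  then have "cc ` {x, y} = d" using component_image_r assms(1) by (simp add: subsetD)
  then show ?thesis using d(2) by simp
qed

lemma zero_on_contract_nonneg: "e \<in> cE \<Longrightarrow> zero_on X (l \<circ> r) e \<ge> 0"
  using pos r_in_E by (auto simp: zero_on_def less_imp_le)

lemma component_in_contract_verts: "u \<in> V \<Longrightarrow> cc u \<in> cV"
  by (simp add: contract_verts_def)

lemma ex_path: "u \<in> V \<Longrightarrow> v \<in> V \<Longrightarrow> \<exists>p. path_between V E u v p"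
  using connected by (auto simp: connected_graph_def)

section \<open>Transfer of walks between \<open>G\<close> and \<open>G/C\<close>\<close>

text \<open>Edges of \<open>C\<close> collapse, edges in the image of \<open>C'\<close> under
  \<open>r\<close> land in \<open>C'\<close>, and for all others the survivor chosen by
  \<open>r\<close> is a shortest parallel edge.\<close>

lemma walk_contract:
  assumes "C' \<subseteq> cE" and "walk V E (zero_on (C \<union> r ` C') l) u v c"
  shows "\<exists>c'\<le>c. walk cV cE (zero_on C' (l \<circ> r)) (cc u) (cc v) c'"
proof (rule walk_project[where f = cc, OF assms(2) component_in_contract_verts zero_on_nonneg])
  fix x y
  assume xy: "x \<in> V" "y \<in> V" "{x, y} \<in> E"
  show "cc x = cc y \<or> {cc x, cc y} \<in> cE \<and>
    zero_on C' (l \<circ> r) {cc x, cc y} \<le> zero_on (C \<union> r ` C') l {x, y}"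
  proof (cases "cc x = cc y")
    case ne: False
    then have e: "{cc x, cc y} \<in> cE" using xy by (auto simp: contract_edges_def)
    have "{x, y} \<notin> C" using ne component_eq_of_edge[OF xy(1,2)] by auto
    moreover have "{cc x, cc y} \<in> C'" if "{x, y} \<in> r ` C'"
      using component_edge_of_r[OF assms(1) that] .
    moreover have "l (r {cc x, cc y}) \<le> l {x, y}"
      by (rule length_r_le[OF e xy(3)]) simp
    \<comment> \<open>Covers an edge that is parallel to a survivor in \<open>C'\<close> without
      being it: its projection has length zero, while it keeps its own length.\<close>
    moreover have "0 \<le> l {x, y}" using pos xy(3) by (simp add: less_imp_le)
    ultimately show ?thesis using e by (simp add: zero_on_def)
  qed simp
qed auto

lemma walk_within_component:
  assumes "u \<in> V" "v \<in> V" "cc u = cc v"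
  shows "walk V E (zero_on (C \<union> X) l) u v 0"
proof -
  have "walk V C (\<lambda>_. 0) u v 0" using assms(3) component_eq_iff[OF assms(1,2)] by simp
  then show ?thesis
  proof (induction rule: walk.induct)
    case (step u w v c)
    have "zero_on (C \<union> X) l {u, w} = 0" using step.hyps(2) by (simp add: zero_on_def)
    moreover have "{u, w} \<in> E" using step.hyps(2) C_sub by blast
    ultimately show ?case using walk.step[OF step.hyps(1) _ step.IH] by metis
  qed (rule walk.refl)
qed

text \<open>Consecutive lifted edges need not share a vertex, only a component, in which a walk of
  length zero joins them. The start \<open>u\<close> is generalized because the induction hypothesis
  is applied at the far end \<open>b\<close> of the lifted edge.\<close>

lemma walk_lift:
  assumes "walk cV cE (zero_on C' (l \<circ> r)) A B c"
    and "u \<in> V" "v \<in> V" "cc u = A" "cc v = B"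
  shows "\<exists>c'\<le>c. walk V E (zero_on (C \<union> r ` C') l) u v c'"
  using assms
proof (induction arbitrary: u rule: walk.induct)
  case (refl A)
  then show ?case using walk_within_component by (intro exI[of _ 0]) auto
next
  case (step A W B c)
  let ?e = "{A, W}" and ?L = "zero_on (C \<union> r ` C') l"
  have im: "cc ` r ?e = ?e" and rE: "r ?e \<in> E"
    using step.hyps(2) component_image_r r_in_E by auto
  obtain x y where "x \<in> V" "y \<in> V" "r ?e = {x, y}"
    using simple rE unfolding simple_graph_def by blast
  \<comment> \<open>The ends of the surviving edge are named so that \<open>a\<close> lies over
    \<open>A\<close> and \<open>b\<close> over \<open>W\<close>.\<close>
  with im obtain a b where ab: "a \<in> V" "b \<in> V" "r ?e = {a, b}" "cc a = A" "cc b = W"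
    by (auto simp: doubleton_eq_iff insert_commute)
  obtain c' where c': "c' \<le> c" "walk V E ?L b v c'"
    using step.IH[of b] ab step.prems by blast
  have "walk V E ?L u a 0" using walk_within_component ab step.prems by simp
  moreover have "walk V E ?L a v (?L {a, b} + c')"
    using ab rE c' by (intro walk.step) auto
  ultimately have "walk V E ?L u v (0 + (?L {a, b} + c'))" by (rule walk_trans)
  \<comment> \<open>Both sides vanish if \<open>?e\<close> is in \<open>C'\<close>; otherwise the
    right side is \<open>l (r ?e)\<close>, which zeroing can only lower.\<close>
  moreover have "?L {a, b} \<le> zero_on C' (l \<circ> r) ?e"
    using zero_on_nonneg[OF rE, of "{}"] ab(3) by (auto simp: zero_on_def)
  ultimately show ?case using c' by (intro exI[of _ "?L {a, b} + c'"]) auto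
qed

lemma ex_path_contract:
  assumes "u \<in> V" "v \<in> V"
  shows "\<exists>p. path_between cV cE (cc u) (cc v) p"
proof -
  obtain p where "path_between V E u v p" using ex_path[OF assms] ..
  from walk_contract[OF _ path_imp_walk[OF this], of "{}"]
  obtain c where "walk cV cE (zero_on {} (l \<circ> r)) (cc u) (cc v) c" by auto
  from walk_imp_path[OF this zero_on_contract_nonneg] show ?thesis by blast
qed

section \<open>Distances and connectivity in \<open>G/C\<close>\<close>

lemma graph_dist_contract:
  assumes "C' \<subseteq> cE" "u \<in> V" "v \<in> V"
  shows "graph_dist cV cE (zero_on C' (l \<circ> r)) (cc u) (cc v) =
    graph_dist V E (zero_on (C \<union> r ` C') l) u v"
proof (rule antisym)
  obtain p where "path_between V E u v p" using ex_path[OF assms(2,3)] ..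
  then show "graph_dist cV cE (zero_on C' (l \<circ> r)) (cc u) (cc v) \<le>
      graph_dist V E (zero_on (C \<union> r ` C') l) u v"
    using zero_on_contract_nonneg walk_contract[OF assms(1)]
    by (rule graph_dist_le_graph_dist)
next
  obtain p where "path_between cV cE (cc u) (cc v) p" using ex_path_contract[OF assms(2,3)] ..
  then show "graph_dist V E (zero_on (C \<union> r ` C') l) u v \<le>
      graph_dist cV cE (zero_on C' (l \<circ> r)) (cc u) (cc v)"
    using zero_on_nonneg walk_lift[OF _ assms(2,3)]
    by (rule graph_dist_le_graph_dist) auto
qed

text \<open>Makes the distance bounded below by the hypothesis on \<open>C\<close> the same number
  as the one to which the hypothesis on \<open>C'\<close> applies \<open>\<psi>\<close>.\<close>

lemma graph_dist_contract_empty: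
  assumes "u \<in> V" "v \<in> V"
  shows "graph_dist cV cE (l \<circ> r) (cc u) (cc v) = graph_dist V E (zero_on C l) u v"
proof -
  have "zero_on {} (l \<circ> r) = l \<circ> r" by (simp add: zero_on_def fun_eq_iff)
  then show ?thesis using graph_dist_contract[of "{}"] assms by simp
qed

text \<open>Zeroing more edges only lowers distances, and nonnegativity stops them at zero.\<close>

lemma graph_dist_zero_on_Un_eq_0:
  assumes "u \<in> V" "v \<in> V" "graph_dist V E (zero_on C l) u v = 0"
  shows "graph_dist V E (zero_on (C \<union> X) l) u v = 0"
proof -
  obtain p where p: "path_between V E u v p" using ex_path[OF assms(1,2)] ..
  have "graph_dist V E (zero_on (C \<union> X) l) u v \<le> graph_dist V E (zero_on C l) u v"
  proof (rule graph_dist_le_graph_dist[OF p zero_on_nonneg])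
    fix c
    assume "walk V E (zero_on C l) u v c"
    then show "\<exists>c'\<le>c. walk V E (zero_on (C \<union> X) l) u v c'"
      \<comment> \<open>Projection along the identity compares two length functions on one
        graph.\<close>
      by (rule walk_project[where f = "\<lambda>x. x"])
        (use zero_on_nonneg[of _ "{}"] in \<open>auto simp: zero_on_def\<close>)
  qed
  moreover have "0 \<le> graph_dist V E (zero_on (C \<union> X) l) u v"
  proof -
    have "0 \<le> c" if "walk V E (zero_on (C \<union> X) l) u v c" for c
      using that by (induction rule: walk.induct) (auto intro: add_nonneg_nonneg zero_on_nonneg)
    then show ?thesis by (rule graph_dist_greatest[OF p])
  qed
  ultimately show ?thesis using assms(3) by simp
qed

text \<open>Used in contrapositive form, to pass disconnectedness from \<open>C'\<close> back to
  \<open>G\<close>. Edges of \<open>C\<close> collapse and the others project into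
  \<open>C'\<close>, so reachability projects.\<close>

lemma connected_graph_contract:
  assumes "C' \<subseteq> cE" "connected_graph V (C \<union> r ` C')"
  shows "connected_graph cV C'"
  unfolding connected_graph_def
proof (intro conjI ballI)
  show "cV \<noteq> {}" using assms(2) by (auto simp: connected_graph_def contract_verts_def)
  fix A B
  assume "A \<in> cV" "B \<in> cV"
  then obtain u v where uv: "u \<in> V" "v \<in> V" "A = cc u" "B = cc v"
    by (auto simp: contract_verts_def)
  then have "walk V (C \<union> r ` C') (\<lambda>_. 0) u v 0"
    using assms(2) unfolding connected_graph_def by (simp add: path_iff_walk)
  then have "\<exists>c'\<le>0. walk cV C' (\<lambda>_. 0) (cc u) (cc v) c'"
  proof (rule walk_project[where f = cc and l' = "\<lambda>_. 0", OF _ component_in_contract_verts])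
    fix x y
    assume xy: "x \<in> V" "y \<in> V" "{x, y} \<in> C \<union> r ` C'"
    show "cc x = cc y \<or> {cc x, cc y} \<in> C' \<and> (0::real) \<le> 0"
    proof (cases "{x, y} \<in> C")
      case True
      then show ?thesis using component_eq_of_edge[OF xy(1,2)] by simp
    next
      case False
      then show ?thesis using component_edge_of_r[OF assms(1)] xy(3) by simp
    qed
  qed auto
  then obtain c' where "walk cV C' (\<lambda>_. 0) (cc u) (cc v) c'" by blast
  from walk_imp_path[OF this] show "\<exists>p. path_between cV C' A B p" using uv by auto
qed

section \<open>Composition of contractions\<close>

lemma contraction_comp:
  assumes "mono \<psi>" "contraction V E l \<phi> C" "contraction cV cE (l \<circ> r) \<psi> C'"
  shows "contraction V E l (\<psi> \<circ> \<phi>) (C \<union> r ` C')"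
  unfolding contraction_def
proof (intro conjI ballI)
  have C': "C' \<subseteq> cE" using assms(3) by (simp add: contraction_def)
  then show "C \<union> r ` C' \<subseteq> E" using C_sub r_in_E by blast
  fix u v
  assume uv: "u \<in> V" "v \<in> V"
  have "(\<psi> \<circ> \<phi>) (graph_dist V E l u v) \<le> \<psi> (graph_dist V E (zero_on C l) u v)"
    using assms(2) uv by (auto simp: contraction_def intro: monoD[OF assms(1)])
  \<comment> \<open>This is the inequality for \<open>C'\<close> at the components of
    \<open>u\<close> and \<open>v\<close>, with both distances carried back to
    \<open>G\<close>.\<close>
  also have "\<dots> \<le> graph_dist V E (zero_on (C \<union> r ` C') l) u v"
    using assms(3) uv component_in_contract_verts
    by (auto simp: contraction_def
        simp flip: graph_dist_contract[OF C' uv] graph_dist_contract_empty[OF uv])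
  finally show "(\<psi> \<circ> \<phi>) (graph_dist V E l u v) \<le> graph_dist V E (zero_on (C \<union> r ` C') l) u v" .
qed

lemma weak_contraction_comp:
  assumes "mono \<psi>" "weak_contraction V E l \<phi> C" "weak_contraction cV cE (l \<circ> r) \<psi> C'"
  shows "weak_contraction V E l (\<psi> \<circ> \<phi>) (C \<union> r ` C')"
  unfolding weak_contraction_def
proof (intro conjI ballI)
  have C': "C' \<subseteq> cE" using assms(3) by (simp add: weak_contraction_def)
  then show "C \<union> r ` C' \<subseteq> E" using C_sub r_in_E by blast
  show "\<not> connected_graph V (C \<union> r ` C')"
    using connected_graph_contract[OF C'] assms(3) by (auto simp: weak_contraction_def)
  fix u v
  assume uv: "u \<in> V" "v \<in> V"
  let ?d = "graph_dist V E (zero_on (C \<union> r ` C') l) u v"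
  have 1: "graph_dist V E (zero_on C l) u v = 0 \<or>
      \<phi> (graph_dist V E l u v) \<le> graph_dist V E (zero_on C l) u v"
    using assms(2) uv by (auto simp: weak_contraction_def)
  have 2: "?d = 0 \<or> \<psi> (graph_dist V E (zero_on C l) u v) \<le> ?d"
    using assms(3) uv component_in_contract_verts
    unfolding weak_contraction_def graph_dist_contract[OF C' uv, symmetric]
      graph_dist_contract_empty[OF uv, symmetric] by blast
  \<comment> \<open>If the distance is zero once \<open>C\<close> is zeroed, so is
    \<open>?d\<close>; otherwise either \<open>?d\<close> is zero or the two inequalities chain by
    monotonicity of \<open>\<psi>\<close>.\<close>
  show "?d = 0 \<or> (\<psi> \<circ> \<phi>) (graph_dist V E l u v) \<le> ?d"
    using 1 2 graph_dist_zero_on_Un_eq_0[OF uv] monoD[OF assms(1)]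
    by (auto intro: order_trans)
qed

end

theorem theorem1:
  fixes V :: "'a set" and E C :: "'a set set" and l :: "'a set \<Rightarrow> real"
    and \<phi> \<psi> :: "real \<Rightarrow> real"
    and r :: "'a set set \<Rightarrow> 'a set" and C' :: "'a set set set"
  assumes "simple_graph V E" and "connected_graph V E"
    and "\<forall>e\<in>E. l e > 0"
    and "mono \<phi>" and "mono \<psi>"
    and "keeps_shortest_parallel V E l C r"
  shows "(contraction V E l \<phi> C \<and>
           contraction (contract_verts V C) (contract_edges V E C) (l \<circ> r) \<psi> C' \<longrightarrow>
           contraction V E l (\<psi> \<circ> \<phi>) (C \<union> r ` C')) \<and>
         (weak_contraction V E l \<phi> C \<and>
           weak_contraction (contract_verts V C) (contract_edges V E C) (l \<circ> r) \<psi> C' \<longrightarrow>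
           weak_contraction V E l (\<psi> \<circ> \<phi>) (C \<union> r ` C'))"
proof -
  have G: "contracted_graph V E C l r" if "C \<subseteq> E"
    using assms that by unfold_locales
  have sub: "contraction V E l \<phi> C \<Longrightarrow> C \<subseteq> E" "weak_contraction V E l \<phi> C \<Longrightarrow> C \<subseteq> E"
    by (simp_all add: contraction_def weak_contraction_def)
  show ?thesis
    using contracted_graph.contraction_comp[OF G assms(5)]
      contracted_graph.weak_contraction_comp[OF G assms(5)] sub by blast
qed

end
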